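(* Let $G=(V,E)$ be a finite simple undirected graph with graph energy $\mathcal{E}(G)$ and Randić index $R(G)$. Then $\mathcal{E}(G)\geq 2R(G)$.
   Context: For a finite simple undirected graph $G=(V,E)$ with vertex set $V=\{v_1,\dots,v_n\}$, let $A\in M_n(\mathbb{R})$ be its adjacency matrix ($A_{ij}=1$ if $v_i$ and $v_j$ are adjacent and $A_{ij}=0$ otherwise), with eigenvalues $\lambda_1,\dots,\lambda_n$ counted with multiplicity. The energy of $G$ is $\mathcal{E}(G)=\sum_{i=1}^n|\lambda_i|$. For a vertex $v$, $\deg(v)$ denotes its degree, i.e. its number of neighbours. The Randić index of $G$ is $R(G)=\sum_{\{v,w\}\in E}\frac{1}{\sqrt{\deg(v)\deg(w)}}$, where each undirected edge is counted once. *)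

theory Defs
  imports
    "Graph_Theory.Pair_Digraph"
    "Jordan_Normal_Form.Char_Poly"
    Complex_Main
begin

text \<open>
  Finite simple undirected graphs are modelled by \<^locale>\<open>pair_graph\<close>: finitely many vertices,
  and a loop-free symmetric set of ordered pairs in which an undirected edge \<open>{v, w}\<close> is
  represented by the two arcs \<open>(v, w)\<close> and \<open>(w, v)\<close>.  Consequently the number of neighbours of
  \<open>v\<close> is \<open>out_degree G v\<close>.
\<close>

definition undirected_edges :: "'a pair_pre_digraph \<Rightarrow> 'a set set" where
  "undirected_edges G = {{v, w} | v w. (v, w) \<in> parcs G}"

text \<open>The list \<open>vs\<close> is the enumeration \<open>v\<^sub>1, \<dots>, v\<^sub>n\<close> of the vertices.\<close>

definition adjacency_matrix :: "'a pair_pre_digraph \<Rightarrow> 'a list \<Rightarrow> real mat" where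
  "adjacency_matrix G vs =
     mat (length vs) (length vs) (\<lambda>(i, j). if (vs ! i, vs ! j) \<in> parcs G then 1 else 0)"

text \<open>
  The eigenvalues are taken over the complex numbers, so that the multiplicities (as roots of the
  characteristic polynomial) add up to the dimension of the matrix without appeal to the spectral
  theorem.
\<close>

definition graph_energy :: "'a pair_pre_digraph \<Rightarrow> 'a list \<Rightarrow> real" where
  "graph_energy G vs =
     (let A = map_mat complex_of_real (adjacency_matrix G vs)
      in \<Sum>z | eigenvalue A z. real (order z (char_poly A)) * cmod z)"

text \<open>For an edge \<open>e = {v, w}\<close> the product below is \<open>deg v * deg w\<close>, as \<open>v \<noteq> w\<close>.\<close>

definition randic_index :: "'a pair_pre_digraph \<Rightarrow> real" where
  "randic_index G =
     (\<Sum>e\<in>undirected_edges G. 1 / sqrt (\<Prod>v\<in>e. real (out_degree G v)))"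

end

theory Submission
  imports Defs "Jordan_Normal_Form.Schur_Decomposition"
begin

text \<open>
  Let \<open>A\<close> be the adjacency matrix, \<open>D\<close> the diagonal matrix of the degrees, and
  \<open>N = D\<^sup>-\<^sup>1\<^sup>/\<^sup>2 A D\<^sup>-\<^sup>1\<^sup>/\<^sup>2\<close> the normalized adjacency matrix, with entries \<open>1 / sqrt (deg v * deg w)\<close>
  at adjacent pairs.  Every edge gives two ones in \<open>A\<close>, so \<open>2 R(G)\<close> is the entrywise pairing
  \<open>\<Sum>\<^sub>i\<^sub>j A\<^sub>i\<^sub>j N\<^sub>i\<^sub>j = tr (A N)\<close>.  The inequality is then the duality between the trace norm and the
  operator norm: the energy is the trace norm of \<open>A\<close>, and \<open>N\<close> has norm at most one.

  In detail, the spectral theorem (\<open>hermitian_spectral_decomposition\<close>) gives orthonormal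
  eigenvectors \<open>u\<^sub>k\<close> with \<open>A = \<Sum>\<^sub>k \<lambda>\<^sub>k u\<^sub>k u\<^sub>k\<^sup>*\<close>.  Hence \<open>2 R(G)\<close> is the sum of \<open>\<lambda>\<^sub>k\<close> times
  the value at \<open>u\<^sub>k\<close> of the form of \<open>N\<close>, and it is at most \<open>\<Sum>\<^sub>k \<bar>\<lambda>\<^sub>k\<bar>\<close> as soon as these values
  are at most one in modulus (\<open>hermitian_pairing_le_sum_eigenvalues\<close>).  This bound on the form of
  \<open>N\<close> is \<open>normalized_adjacency_form_le\<close>: by \<open>2 a b \<le> a\<^sup>2 + b\<^sup>2\<close> an arc from \<open>v\<close> to \<open>w\<close> contributes
  at most half of \<open>\<bar>x\<^sub>v\<bar>\<^sup>2 / deg v + \<bar>x\<^sub>w\<bar>\<^sup>2 / deg w\<close>, and the arcs at a vertex \<open>v\<close> together collect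
  at most \<open>\<bar>x\<^sub>v\<bar>\<^sup>2\<close>.
\<close>

section \<open>Adjoints and block-diagonal matrices\<close>

lemma mat_adjoint_carrier [simp]:
  "A \<in> carrier_mat m n \<Longrightarrow> mat_adjoint A \<in> carrier_mat n m"
  unfolding mat_adjoint_def by (auto simp: mat_of_rows_def)

lemma mat_adjoint_dim [simp]:
  "dim_row (mat_adjoint A) = dim_col A" "dim_col (mat_adjoint A) = dim_row A"
  unfolding mat_adjoint_def by auto

lemma mat_adjoint_index:
  fixes A :: "complex mat"
  assumes "A \<in> carrier_mat m n" "i < n" "j < m"
  shows "mat_adjoint A $$ (i, j) = cnj (A $$ (j, i))"
  using assms unfolding mat_adjoint_def by (auto simp: mat_of_rows_index)

lemma mat_adjoint_mult:
  fixes A :: "complex mat"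
  assumes A: "A \<in> carrier_mat l m" and B: "B \<in> carrier_mat m n"
  shows "mat_adjoint (A * B) = mat_adjoint B * mat_adjoint A"
proof (rule eq_matI)
  note c = mult_carrier_mat[OF A B] mat_adjoint_carrier[OF A] mat_adjoint_carrier[OF B]
  show "dim_row (mat_adjoint (A * B)) = dim_row (mat_adjoint B * mat_adjoint A)"
    "dim_col (mat_adjoint (A * B)) = dim_col (mat_adjoint B * mat_adjoint A)" by auto
  fix i j assume "i < dim_row (mat_adjoint B * mat_adjoint A)"
    "j < dim_col (mat_adjoint B * mat_adjoint A)"
  hence ij: "i < n" "j < l" using A B c by auto
  show "mat_adjoint (A * B) $$ (i, j) = (mat_adjoint B * mat_adjoint A) $$ (i, j)"
    unfolding mat_adjoint_index[OF c(1) ij]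
    using A B c ij
    by (simp add: scalar_prod_def mat_adjoint_index[OF A] mat_adjoint_index[OF B] mult.commute)
qed

lemma mat_adjoint_adjoint:
  fixes A :: "complex mat"
  assumes A: "A \<in> carrier_mat m n"
  shows "mat_adjoint (mat_adjoint A) = A"
  using A mat_adjoint_carrier[OF A] mat_adjoint_carrier[OF mat_adjoint_carrier[OF A]]
  by (intro eq_matI)
    (auto simp: mat_adjoint_index[OF A] mat_adjoint_index[OF mat_adjoint_carrier[OF A]])

lemma mat_adjoint_block_one:
  fixes B :: "complex mat"
  assumes B: "B \<in> carrier_mat n n"
  shows "mat_adjoint (four_block_mat (1\<^sub>m 1) (0\<^sub>m 1 n) (0\<^sub>m n 1) B)
    = four_block_mat (1\<^sub>m 1) (0\<^sub>m 1 n) (0\<^sub>m n 1) (mat_adjoint B)" (is "mat_adjoint ?L = ?R")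
proof -
  have L: "?L \<in> carrier_mat (Suc n) (Suc n)" using B by auto
  note LA = mat_adjoint_carrier[OF L]
  have R: "?R \<in> carrier_mat (Suc n) (Suc n)" using B by (auto intro!: carrier_matI)
  show ?thesis
  proof (rule eq_matI)
    fix i j assume "i < dim_row ?R" "j < dim_col ?R"
    hence ij: "i < Suc n" "j < Suc n" using R by (auto simp del: index_mat_four_block)
    show "mat_adjoint ?L $$ (i, j) = ?R $$ (i, j)"
      unfolding mat_adjoint_index[OF L ij] using ij carrier_matD[OF B]
      by (cases "i = 0"; cases "j = 0") (auto simp: mat_adjoint_index[OF B])
  qed (use LA R in \<open>auto simp del: index_mat_four_block\<close>)
qed

lemma mult_block_diagonal:
  fixes A1 A2 B1 B2 :: "'a :: semiring_0 mat"
  assumes "A1 \<in> carrier_mat k k" "A2 \<in> carrier_mat k k"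
    and "B1 \<in> carrier_mat m m" "B2 \<in> carrier_mat m m"
  shows "four_block_mat A1 (0\<^sub>m k m) (0\<^sub>m m k) B1 * four_block_mat A2 (0\<^sub>m k m) (0\<^sub>m m k) B2
    = four_block_mat (A1 * A2) (0\<^sub>m k m) (0\<^sub>m m k) (B1 * B2)"
  using assms by (subst mult_four_block_mat[of _ k k _ m _ m _ _ k _ m]) auto

section \<open>The spectral theorem for Hermitian matrices\<close>

text \<open>
  Complete \<open>v\<close> to a basis and orthogonalize it: Gram--Schmidt leaves the first vector alone, so after
  normalization the first column is a multiple of \<open>v\<close>.
\<close>

lemma unitary_with_first_column:
  fixes v :: "complex vec"
  assumes v: "v \<in> carrier_vec n" and v0: "v \<noteq> 0\<^sub>v n"
  shows "\<exists>W \<in> carrier_mat n n. \<exists>c. mat_adjoint W * W = 1\<^sub>m n \<and> col W 0 = c \<cdot>\<^sub>v v"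
proof -
  interpret cof_vec_space n "TYPE(complex)" .
  define b where "b = basis_completion v"
  define ws where "ws = gram_schmidt n b"
  from basis_completion[OF v v0, folded b_def]
  have dist_b: "distinct b" and indep: "\<not> lin_dep (set b)" and b: "set b \<subseteq> carrier_vec n"
    and hdb: "hd b = v" and len_b: "length b = n" by auto
  have n: "0 < n" using v v0 by (cases n) auto
  from hdb len_b n obtain vs where bv: "b = v # vs" by (cases b, auto)
  from gram_schmidt_result[OF b dist_b indep refl, folded ws_def]
  have ws: "set ws \<subseteq> carrier_vec n" "corthogonal ws" "length ws = n"
    by (auto simp: len_b)
  have hdws: "ws ! 0 = v"
    using gram_schmidt_hd[OF v, of vs, folded bv] ws(3) n unfolding ws_def
    by (metis hd_conv_nth length_0_conv less_irrefl)
  have wsc: "ws ! j \<in> carrier_vec n" if "j < n" for j using ws that by auto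
  \<comment> \<open>\<open>r j\<close> is the Euclidean norm of the \<open>j\<close>-th orthogonal vector, taken as a complex number.\<close>
  define r where "r j = complex_of_real (sqrt (Re (ws ! j \<bullet>c ws ! j)))" for j
  have r: "r j * r j = ws ! j \<bullet>c ws ! j" "r j \<noteq> 0" if j: "j < n" for j
  proof -
    have nz: "ws ! j \<bullet>c ws ! j \<noteq> 0" using corthogonalD[OF ws(2)] ws(3) j by auto
    have "ws ! j \<bullet>c ws ! j \<ge> 0" by (rule conjugate_square_ge_0_vec)
    hence *: "Re (ws ! j \<bullet>c ws ! j) \<ge> 0" "Im (ws ! j \<bullet>c ws ! j) = 0"
      by (auto simp: less_eq_complex_def)
    show "r j * r j = ws ! j \<bullet>c ws ! j"
      unfolding r_def of_real_mult[symmetric] using * by (simp add: complex_eq_iff)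
    thus "r j \<noteq> 0" using nz by auto
  qed
  have cr: "cnj (r j) = r j" for j unfolding r_def by simp
  define W where "W = mat n n (\<lambda>(i, j). ws ! j $ i / r j)"
  have W: "W \<in> carrier_mat n n" unfolding W_def by simp
  have "mat_adjoint W * W = 1\<^sub>m n"
  proof (rule eq_matI)
    fix i j assume "i < dim_row (1\<^sub>m n)" "j < dim_col (1\<^sub>m n)"
    hence ij: "i < n" "j < n" by auto
    have "(mat_adjoint W * W) $$ (i, j) = (\<Sum>k<n. cnj (ws ! i $ k / r i) * (ws ! j $ k / r j))"
      using W ij
      by (simp add: scalar_prod_def mat_adjoint_index[OF W] atLeast0LessThan) (simp add: W_def)
    also have "\<dots> = (ws ! j \<bullet>c ws ! i) / (r i * r j)"
      using wsc[OF ij(1)] by (simp add: scalar_prod_def atLeast0LessThan sum_divide_distrib cr ac_simps)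
    also have "\<dots> = 1\<^sub>m n $$ (i, j)"
      using ij r[OF ij(1)] corthogonalD[OF ws(2), of j i] ws(3) by auto
    finally show "(mat_adjoint W * W) $$ (i, j) = 1\<^sub>m n $$ (i, j)" .
  qed (use W mat_adjoint_carrier[OF W] in auto)
  moreover have "col W 0 = (1 / r 0) \<cdot>\<^sub>v v"
    using n v unfolding W_def by (intro eq_vecI) (auto simp: hdws)
  ultimately show ?thesis using W by blast
qed

lemma unitary_conjugation_similar:
  fixes A W :: "complex mat"
  assumes A: "A \<in> carrier_mat n n" and W: "W \<in> carrier_mat n n"
    and WW: "mat_adjoint W * W = 1\<^sub>m n"
  shows "W * mat_adjoint W = 1\<^sub>m n"
    and "W * (mat_adjoint W * A * W) * mat_adjoint W = A"
    and "char_poly (mat_adjoint W * A * W) = char_poly A"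
proof -
  note Wa = mat_adjoint_carrier[OF W]
  show WW': "W * mat_adjoint W = 1\<^sub>m n"
    by (rule mat_mult_left_right_inverse[OF Wa W WW])
  have "W * (mat_adjoint W * A * W) * mat_adjoint W
    = (W * mat_adjoint W) * A * (W * mat_adjoint W)"
    using A W Wa by (simp add: assoc_mult_mat[of _ n n _ n _ n] mult_carrier_mat[of _ n n _ n])
  thus eq: "W * (mat_adjoint W * A * W) * mat_adjoint W = A" using WW' A by simp
  have "similar_mat_wit A (mat_adjoint W * A * W) W (mat_adjoint W)"
    by (rule similar_mat_witI[of _ _ n]) (use A W Wa WW WW' eq in auto)
  thus "char_poly (mat_adjoint W * A * W) = char_poly A"
    using char_poly_similar unfolding similar_mat_def by metis
qed

text \<open>
  Deflation.  In a unitary basis that starts with an eigenvector for \<open>e\<close>, the first column of the matrix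
  is \<open>e\<close> times the first standard basis vector.  By symmetry so is the first row, and the rest is a smaller
  Hermitian matrix whose characteristic polynomial has lost exactly the factor of \<open>e\<close>.  Tracking
  this factor is what makes the diagonal list each eigenvalue as often as its algebraic
  multiplicity says.
\<close>

theorem hermitian_spectral_decomposition:
  fixes A :: "complex mat"
  assumes "A \<in> carrier_mat n n" and "mat_adjoint A = A"
    and "char_poly A = (\<Prod>e\<leftarrow>es. [:- e, 1:])" and "length es = n"
  shows "\<exists>U \<in> carrier_mat n n. mat_adjoint U * U = 1\<^sub>m n \<and>
    A = U * mat_diag n (\<lambda>i. es ! i) * mat_adjoint U"
  using assms
proof (induction es arbitrary: n A)
  case Nil
  have a: "mat_adjoint (1\<^sub>m 0) \<in> carrier_mat 0 (0::nat)"
    by (rule mat_adjoint_carrier) simp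
  show ?case
    by (rule bexI[of _ "1\<^sub>m 0"]) (use Nil a in \<open>auto intro!: eq_matI\<close>)
next
  case (Cons e es n A)
  define m where "m = length es"
  have nm: "n = Suc m" using Cons.prems(4) m_def by simp
  note A = Cons.prems(1) and herm = Cons.prems(2)
  have "eigenvalue A e" unfolding eigenvalue_root_char_poly[OF A] Cons.prems(3) by simp
  then obtain v where v: "v \<in> carrier_vec n" "v \<noteq> 0\<^sub>v n" "A *\<^sub>v v = e \<cdot>\<^sub>v v"
    using A unfolding eigenvalue_def eigenvector_def by auto
  from unitary_with_first_column[OF v(1,2)] obtain W c where
    W: "W \<in> carrier_mat n n" and WW: "mat_adjoint W * W = 1\<^sub>m n" and W0: "col W 0 = c \<cdot>\<^sub>v v"
    by blast
  note Wa = mat_adjoint_carrier[OF W]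
  note conj = unitary_conjugation_similar[OF A W WW]
  define A' where "A' = mat_adjoint W * A * W"
  have A': "A' \<in> carrier_mat n n" unfolding A'_def using A W Wa by auto
  have "mat_adjoint A' = mat_adjoint W * (A * W)"
    unfolding A'_def mat_adjoint_mult[OF mult_carrier_mat[OF Wa A] W] mat_adjoint_mult[OF Wa A]
      mat_adjoint_adjoint[OF W] herm using A W Wa
    by simp
  hence herm': "mat_adjoint A' = A'"
    unfolding A'_def using A W Wa
    by (simp add: assoc_mult_mat[of _ n n _ n _ n] mult_carrier_mat[of _ n n _ n])
  have cj: "A' $$ (i, j) = cnj (A' $$ (j, i))" if "i < n" "j < n" for i j
    using mat_adjoint_index[OF A' that] herm' by simp
  have eigW: "A *\<^sub>v col W 0 = e \<cdot>\<^sub>v col W 0"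
    unfolding W0 using A v by (simp add: mult_mat_vec smult_smult_assoc mult.commute)
  have col0: "A' $$ (i, 0) = (if i = 0 then e else 0)" if i: "i < n" for i
  proof -
    have "A' = mat_adjoint W * (A * W)"
      unfolding A'_def by (rule assoc_mult_mat[OF Wa A W])
    hence "A' $$ (i, 0) = row (mat_adjoint W) i \<bullet> col (A * W) 0"
      using A W i nm by simp
    also have "col (A * W) 0 = A *\<^sub>v col W 0" using col_mult2[OF A W] nm by simp
    also have "row (mat_adjoint W) i \<bullet> (A *\<^sub>v col W 0) = row (mat_adjoint W) i \<bullet> (e \<cdot>\<^sub>v col W 0)"
      unfolding eigW ..
    also have "\<dots> = e * (mat_adjoint W * W) $$ (i, 0)"
      using W Wa i nm by (simp add: carrier_vecI)
    finally show ?thesis unfolding WW using i nm by simp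
  qed
  have row0: "A' $$ (0, i) = 0" if "i < n" "i \<noteq> 0" for i
    using cj[of 0 i] col0[of i] that nm by simp
  define A3 where "A3 = mat m m (\<lambda>(i, j). A' $$ (Suc i, Suc j))"
  have A3: "A3 \<in> carrier_mat m m" unfolding A3_def by simp
  have block: "A' = four_block_mat (mat 1 1 (\<lambda>_. e)) (0\<^sub>m 1 m) (0\<^sub>m m 1) A3"
    by (rule eq_matI) (use A' A3 nm col0 row0 in \<open>auto simp: A3_def\<close>)
  have herm3: "mat_adjoint A3 = A3"
  proof (rule eq_matI)
    fix i j assume "i < dim_row A3" "j < dim_col A3"
    hence ij: "i < m" "j < m" using A3 by auto
    show "mat_adjoint A3 $$ (i, j) = A3 $$ (i, j)"
      unfolding mat_adjoint_index[OF A3 ij] using ij cj[of "Suc i" "Suc j"] nm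
      by (simp add: A3_def)
  qed (use A3 in auto)
  have "char_poly A' = char_poly (mat 1 1 (\<lambda>_. e)) * char_poly A3"
    unfolding block by (rule char_poly_four_block_zeros_col) (use A3 in auto)
  also have "char_poly (mat 1 1 (\<lambda>_. e)) = [: -e, 1 :]"
    by (simp add: char_poly_defs det_def sign_def)
  finally have "[: -e, 1 :] * char_poly A3 = [: -e, 1 :] * (\<Prod>e\<leftarrow>es. [:- e, 1:])"
    using conj(3) Cons.prems(3) unfolding A'_def by simp
  hence "char_poly A3 = (\<Prod>e\<leftarrow>es. [:- e, 1:])"
    by (metis mult_cancel_left pCons_eq_0_iff zero_neq_one)
  from Cons.IH[OF A3 herm3 this m_def[symmetric]] obtain V where
    V: "V \<in> carrier_mat m m" and VV: "mat_adjoint V * V = 1\<^sub>m m"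
    and A3V: "A3 = V * mat_diag m (\<lambda>i. es ! i) * mat_adjoint V" by blast
  note Va = mat_adjoint_carrier[OF V]
  define X where "X = four_block_mat (1\<^sub>m 1) (0\<^sub>m 1 m) (0\<^sub>m m 1) V"
  have X: "X \<in> carrier_mat n n" unfolding X_def nm using V by auto
  note Xa = mat_adjoint_carrier[OF X]
  have Xadj: "mat_adjoint X = four_block_mat (1\<^sub>m 1) (0\<^sub>m 1 m) (0\<^sub>m m 1) (mat_adjoint V)"
    unfolding X_def by (rule mat_adjoint_block_one[OF V])
  let ?D = "mat_diag n (\<lambda>i. (e # es) ! i)"
  have D: "?D = four_block_mat (mat 1 1 (\<lambda>_. e)) (0\<^sub>m 1 m) (0\<^sub>m m 1) (mat_diag m (\<lambda>i. es ! i))"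
    by (rule eq_matI) (auto simp: nm mat_diag_def)
  have Dc: "?D \<in> carrier_mat n n" by simp
  have XX: "mat_adjoint X * X = 1\<^sub>m n"
    unfolding Xadj unfolding X_def mult_block_diagonal[OF one_carrier_mat one_carrier_mat Va V] VV nm
    by (auto intro!: eq_matI)
  have XDX: "X * ?D * mat_adjoint X = A'"
    unfolding Xadj D block A3V unfolding X_def
      mult_block_diagonal[OF one_carrier_mat mat_carrier V mat_diag_dim]
      mult_block_diagonal[OF mult_carrier_mat[OF one_carrier_mat mat_carrier] one_carrier_mat
        mult_carrier_mat[OF V mat_diag_dim] Va]
    by simp
  define U where "U = W * X"
  have U: "U \<in> carrier_mat n n" unfolding U_def using W X by auto
  have Ua: "mat_adjoint U = mat_adjoint X * mat_adjoint W"
    unfolding U_def by (rule mat_adjoint_mult[OF W X])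
  have "mat_adjoint U * U = mat_adjoint X * (mat_adjoint W * W) * X"
    unfolding Ua unfolding U_def using W Wa X Xa by (simp add: assoc_mult_mat[of _ n n _ n _ n] mult_carrier_mat[of _ n n _ n])
  hence UU: "mat_adjoint U * U = 1\<^sub>m n" by (simp only: WW right_mult_one_mat[OF Xa] XX)
  have "U * ?D * mat_adjoint U = W * (X * ?D * mat_adjoint X) * mat_adjoint W"
    unfolding Ua unfolding U_def using W Wa X Xa Dc by (simp add: assoc_mult_mat[of _ n n _ n _ n] mult_carrier_mat[of _ n n _ n])
  also have "\<dots> = A" unfolding XDX unfolding A'_def by (rule conj(2))
  finally show ?case using U UU by metis
qed


section \<open>Sums over eigenvalues\<close>

lemma order_prod_list_linear:
  fixes z :: "'a :: idom"
  shows "Polynomial.order z (\<Prod>e\<leftarrow>es. [:- e, 1:]) = count_list es z"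
proof (induction es)
  case (Cons e es)
  have nz: "(\<Prod>e\<leftarrow>e # es. [:- e, 1:]) \<noteq> 0"
    by (subst prod_list_zero_iff) auto
  have "Polynomial.order z [:- e, 1:] = (if e = z then 1 else 0)"
    using order_power_n_n[of e 1] by (auto intro!: order_0I)
  thus ?case using Cons order_mult[of "[:- e, 1:]" "\<Prod>e\<leftarrow>es. [:- e, 1:]" z] nz
    by (simp del: mult_pCons_left)
qed simp

lemma sum_order_char_poly:
  fixes A :: "complex mat"
  assumes A: "A \<in> carrier_mat n n" and es: "char_poly A = (\<Prod>e\<leftarrow>es. [:- e, 1:])"
  shows "(\<Sum>z | eigenvalue A z. real (Polynomial.order z (char_poly A)) * f z) = (\<Sum>e\<leftarrow>es. f e)"
proof -
  have eigenvalues: "{z. eigenvalue A z} = set es"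
    unfolding eigenvalue_root_char_poly[OF A] es by (auto simp: poly_prod_list_zero_iff)
  have "(\<Sum>z\<in>X. real (count_list es z) * f z) = (\<Sum>e\<leftarrow>es. f e)"
    if "finite X" "set es \<subseteq> X" for X
    using that
  proof (induction es)
    case (Cons e es)
    have "(\<Sum>z\<in>X. real (count_list (e # es) z) * f z)
      = (\<Sum>z\<in>X. (if z = e then f z else 0) + real (count_list es z) * f z)"
      by (intro sum.cong) (auto simp: distrib_right)
    thus ?case using Cons by (simp add: sum.distrib)
  qed simp
  from this[of "set es"] show ?thesis
    unfolding eigenvalues unfolding es order_prod_list_linear by simp
qed

text \<open>
  The trace norm of \<open>A\<close> dominates its pairing with every \<open>B\<close> whose form is bounded by the squared norm:
  expanding \<open>A\<close> in its orthonormal eigenvectors turns the pairing into a combination of values of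
  the form of \<open>B\<close> at unit vectors, with the eigenvalues as coefficients.
\<close>

lemma hermitian_pairing_le_sum_eigenvalues:
  fixes A :: "complex mat" and B :: "nat \<Rightarrow> nat \<Rightarrow> complex"
  assumes A: "A \<in> carrier_mat n n" and herm: "mat_adjoint A = A"
    and es: "char_poly A = (\<Prod>e\<leftarrow>es. [:- e, 1:])" "length es = n"
    and B: "\<And>x. cmod (\<Sum>i<n. \<Sum>j<n. x i * cnj (x j) * B i j) \<le> (\<Sum>i<n. (cmod (x i))\<^sup>2)"
  shows "cmod (\<Sum>i<n. \<Sum>j<n. A $$ (i, j) * B i j) \<le> (\<Sum>e\<leftarrow>es. cmod e)"
proof -
  from hermitian_spectral_decomposition[OF A herm es] obtain U where
    U: "U \<in> carrier_mat n n" and UU: "mat_adjoint U * U = 1\<^sub>m n"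
    and AU: "A = U * mat_diag n (\<lambda>i. es ! i) * mat_adjoint U" by blast
  \<comment> \<open>\<open>q k\<close> is the form of \<open>B\<close> at the \<open>k\<close>-th column of \<open>U\<close>, a unit eigenvector.\<close>
  define q where "q k = (\<Sum>i<n. \<Sum>j<n. U $$ (i, k) * cnj (U $$ (j, k)) * B i j)" for k
  have entry: "A $$ (i, j) = (\<Sum>k<n. es ! k * (U $$ (i, k) * cnj (U $$ (j, k))))"
    if "i < n" "j < n" for i j
    unfolding AU mat_diag_mult_right[OF U] using U that
    by (simp add: scalar_prod_def atLeast0LessThan mat_adjoint_index[OF U] ac_simps)
  have q: "cmod (q k) \<le> 1" if k: "k < n" for k
  proof -
    have "complex_of_real (\<Sum>i<n. (cmod (U $$ (i, k)))\<^sup>2) = (mat_adjoint U * U) $$ (k, k)"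
      using U k by (simp add: scalar_prod_def atLeast0LessThan mat_adjoint_index[OF U]
        complex_norm_square mult.commute del: of_real_power)
    hence "(\<Sum>i<n. (cmod (U $$ (i, k)))\<^sup>2) = 1"
      unfolding UU using k by (simp add: of_real_eq_1_iff del: of_real_sum)
    thus ?thesis using B[of "\<lambda>i. U $$ (i, k)"] unfolding q_def by simp
  qed
  have "(\<Sum>i<n. \<Sum>j<n. A $$ (i, j) * B i j)
    = (\<Sum>i<n. \<Sum>j<n. \<Sum>k<n. es ! k * (U $$ (i, k) * cnj (U $$ (j, k)) * B i j))"
    by (simp add: entry sum_distrib_right mult.assoc)
  also have "\<dots> = (\<Sum>i<n. \<Sum>k<n. \<Sum>j<n. es ! k * (U $$ (i, k) * cnj (U $$ (j, k)) * B i j))"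
    by (intro sum.cong refl sum.swap)
  also have "\<dots> = (\<Sum>k<n. \<Sum>i<n. \<Sum>j<n. es ! k * (U $$ (i, k) * cnj (U $$ (j, k)) * B i j))"
    by (rule sum.swap)
  also have "\<dots> = (\<Sum>k<n. es ! k * q k)"
    unfolding q_def by (simp add: sum_distrib_left)
  finally have "cmod (\<Sum>i<n. \<Sum>j<n. A $$ (i, j) * B i j) \<le> (\<Sum>k<n. cmod (es ! k * q k))"
    by (simp add: norm_sum)
  also have "\<dots> \<le> (\<Sum>k<n. cmod (es ! k))"
    by (intro sum_mono) (use q in \<open>auto simp: norm_mult intro: mult_left_le\<close>)
  also have "\<dots> = (\<Sum>e\<leftarrow>es. cmod e)"
    using es(2) by (simp add: sum_list_sum_nth atLeast0LessThan)
  finally show ?thesis .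
qed

section \<open>Sums over arcs and the normalized adjacency form\<close>

context
  fixes G :: "'a pair_pre_digraph"
  assumes G: "pair_graph G"
begin

interpretation pair_graph G by (rule G)

lemma arcs_swap: "(v, w) \<in> parcs G \<longleftrightarrow> (w, v) \<in> parcs G"
  using pair_sym_arcs unfolding symmetric_def by (auto elim: symE)

lemma twice_randic_index:
  "2 * randic_index G =
    (\<Sum>(v, w)\<in>parcs G. 1 / sqrt (real (out_degree G v) * real (out_degree G w)))"
proof -
  let ?g = "\<lambda>(v, w). 1 / sqrt (real (out_degree G v) * real (out_degree G w))"
  let ?h = "\<lambda>(v, w). {v, w}"
  have im: "?h ` parcs G = undirected_edges G"
    unfolding undirected_edges_def by auto
  have "(\<Sum>a | a \<in> parcs G \<and> ?h a = e. ?g a) = 2 * (1 / sqrt (\<Prod>v\<in>e. real (out_degree G v)))"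
    if e: "e \<in> undirected_edges G" for e
  proof -
    obtain v w where vw: "e = {v, w}" "(v, w) \<in> parcs G"
      using e unfolding undirected_edges_def by auto
    \<comment> \<open>Without loops the two orientations of an edge are different arcs, whence the factor two.\<close>
    have ne: "v \<noteq> w" using pair_no_loops[OF vw(2)] by simp
    have "{a. a \<in> parcs G \<and> ?h a = e} = {(v, w), (w, v)}"
      using vw arcs_swap by (auto simp: doubleton_eq_iff)
    thus ?thesis using ne vw by (simp add: mult.commute)
  qed
  hence "2 * randic_index G = (\<Sum>e\<in>?h ` parcs G. \<Sum>a | a \<in> parcs G \<and> ?h a = e. ?g a)"
    unfolding im randic_index_def sum_distrib_left by simp
  also have "\<dots> = (\<Sum>a\<in>parcs G. ?g a)"
    by (rule sum.image_gen[OF pair_finite_arcs, symmetric])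
  finally show ?thesis by simp
qed

text \<open>
  The \<open>deg v\<close> arcs that leave \<open>v\<close> contribute \<open>g v / deg v\<close> each.  There is no equality in general,
  because an isolated vertex contributes nothing to the left-hand side.
\<close>

lemma sum_arcs_tail_over_degree_le:
  fixes g :: "'a \<Rightarrow> real"
  assumes "\<And>v. g v \<ge> 0"
  shows "(\<Sum>(v, w)\<in>parcs G. g v / real (out_degree G v)) \<le> (\<Sum>v\<in>pverts G. g v)"
proof -
  have "(\<Sum>(v, w)\<in>parcs G. g v / real (out_degree G v))
    = (\<Sum>v\<in>pverts G. \<Sum>a | a \<in> parcs G \<and> fst a = v. g (fst a) / real (out_degree G (fst a)))"
    by (subst sum.group) (auto simp: pair_finite_arcs pair_finite_verts case_prod_beta dest: in_arcsD1)
  also have "\<dots> = (\<Sum>v\<in>pverts G. real (out_degree G v) * (g v / real (out_degree G v)))"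
    by (intro sum.cong refl) (auto simp: out_degree_def out_arcs_def)
  also have "\<dots> \<le> (\<Sum>v\<in>pverts G. g v)"
    by (intro sum_mono) (use assms in auto)
  finally show ?thesis .
qed

text \<open>
  The form of the normalized adjacency matrix is bounded by the squared norm: split every arc term
  with \<open>2 a b \<le> a\<^sup>2 + b\<^sup>2\<close>; reversing the arcs shows that both halves have the same sum.
\<close>

lemma normalized_adjacency_form_le:
  fixes f :: "'a \<Rightarrow> real"
  shows "(\<Sum>(v, w)\<in>parcs G. \<bar>f v\<bar> * \<bar>f w\<bar> / sqrt (real (out_degree G v) * real (out_degree G w)))
    \<le> (\<Sum>v\<in>pverts G. (f v)\<^sup>2)"
proof -
  let ?d = "\<lambda>v. real (out_degree G v)"
  have "(\<Sum>(v, w)\<in>parcs G. \<bar>f v\<bar> * \<bar>f w\<bar> / sqrt (?d v * ?d w))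
    \<le> (\<Sum>(v, w)\<in>parcs G. ((f v)\<^sup>2 / ?d v + (f w)\<^sup>2 / ?d w) / 2)"
  proof (intro sum_mono, clarify)
    fix v w
    have "2 * (\<bar>f v\<bar> / sqrt (?d v)) * (\<bar>f w\<bar> / sqrt (?d w))
      \<le> (\<bar>f v\<bar> / sqrt (?d v))\<^sup>2 + (\<bar>f w\<bar> / sqrt (?d w))\<^sup>2"
      by (rule sum_squares_bound)
    thus "\<bar>f v\<bar> * \<bar>f w\<bar> / sqrt (?d v * ?d w) \<le> ((f v)\<^sup>2 / ?d v + (f w)\<^sup>2 / ?d w) / 2"
      by (simp add: power_divide real_sqrt_mult ac_simps)
  qed
  also have "\<dots> = ((\<Sum>(v, w)\<in>parcs G. (f v)\<^sup>2 / ?d v) + (\<Sum>(v, w)\<in>parcs G. (f w)\<^sup>2 / ?d w)) / 2"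
    by (simp add: case_prod_beta sum.distrib sum_divide_distrib add_divide_distrib)
  also have "(\<Sum>(v, w)\<in>parcs G. (f w)\<^sup>2 / ?d w) = (\<Sum>(v, w)\<in>parcs G. (f v)\<^sup>2 / ?d v)"
    by (rule sum.reindex_bij_witness[of _ prod.swap prod.swap]) (auto simp: arcs_swap)
  finally show ?thesis
    using sum_arcs_tail_over_degree_le[of "\<lambda>v. (f v)\<^sup>2"] by simp
qed

lemma sum_arcs_by_index:
  fixes h :: "'a \<Rightarrow> 'a \<Rightarrow> 'b :: comm_monoid_add"
  assumes vs: "distinct vs" "set vs = pverts G"
  shows "(\<Sum>i<length vs. \<Sum>j<length vs.
      if (vs ! i, vs ! j) \<in> parcs G then h (vs ! i) (vs ! j) else 0)
    = (\<Sum>(v, w)\<in>parcs G. h v w)"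
proof -
  have bij: "bij_betw (\<lambda>i. vs ! i) {..<length vs} (pverts G)"
    using bij_betw_nth[OF vs(1)] vs(2) by simp
  have "(\<Sum>i<length vs. \<Sum>j<length vs.
      if (vs ! i, vs ! j) \<in> parcs G then h (vs ! i) (vs ! j) else 0)
    = (\<Sum>v\<in>pverts G. \<Sum>w\<in>pverts G. if (v, w) \<in> parcs G then h v w else 0)"
    by (simp flip: sum.reindex_bij_betw[OF bij])
  also have "\<dots> = (\<Sum>(v, w)\<in>pverts G \<times> pverts G. if (v, w) \<in> parcs G then h v w else 0)"
    by (rule sum.cartesian_product)
  also have "\<dots> = (\<Sum>(v, w)\<in>parcs G. h v w)"
    by (rule sum.mono_neutral_cong_right)
      (auto simp: pair_finite_verts dest: in_arcsD1 in_arcsD2)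
  finally show ?thesis .
qed

end

section \<open>Energy and the Randic index\<close>

theorem theorem6:
  fixes G :: "'a pair_pre_digraph" and vs :: "'a list"
  assumes "pair_graph G"
    and "distinct vs" and "set vs = pverts G"
  shows "graph_energy G vs \<ge> 2 * randic_index G"
proof -
  define n where "n = length vs"
  define A where "A = map_mat complex_of_real (adjacency_matrix G vs)"
  let ?d = "\<lambda>v. real (out_degree G v)"
  let ?r = "\<lambda>v w. 1 / sqrt (?d v * ?d w)"
  \<comment> \<open>The normalized adjacency matrix, indexed by positions in \<open>vs\<close>.\<close>
  define B where "B i j = (if (vs ! i, vs ! j) \<in> parcs G
    then complex_of_real (?r (vs ! i) (vs ! j)) else 0)" for i j
  note by_index = sum_arcs_by_index[OF assms, folded n_def]
  have A: "A \<in> carrier_mat n n"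
    unfolding A_def adjacency_matrix_def n_def by simp
  have A_entry: "A $$ (i, j) = (if (vs ! i, vs ! j) \<in> parcs G then 1 else 0)"
    if "i < n" "j < n" for i j
    using that unfolding A_def adjacency_matrix_def n_def by simp
  have herm: "mat_adjoint A = A"
    by (rule eq_matI)
      (use A arcs_swap[OF assms(1)] in \<open>auto simp: mat_adjoint_index[OF A] A_entry\<close>)
  obtain es where es: "char_poly A = (\<Prod>e\<leftarrow>es. [:- e, 1:])" "length es = n"
    using char_poly_factorized[OF A] by blast
  have form: "cmod (\<Sum>i<n. \<Sum>j<n. x i * cnj (x j) * B i j) \<le> (\<Sum>i<n. (cmod (x i))\<^sup>2)"
    for x :: "nat \<Rightarrow> complex"
  proof -
    \<comment> \<open>\<open>f\<close> carries the moduli of the coordinates over from positions to vertices.\<close>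
    define f where "f v = cmod (x (inv_into {..<n} (\<lambda>i. vs ! i) v))" for v
    have bij: "bij_betw (\<lambda>i. vs ! i) {..<n} (pverts G)"
      using bij_betw_nth[OF assms(2)] assms(3) n_def by simp
    have f: "f (vs ! i) = cmod (x i)" if "i < n" for i
      unfolding f_def using bij_betw_inv_into_left[OF bij] that by simp
    have "cmod (\<Sum>i<n. \<Sum>j<n. x i * cnj (x j) * B i j)
      \<le> (\<Sum>i<n. \<Sum>j<n. cmod (x i * cnj (x j) * B i j))"
      by (intro order_trans[OF norm_sum] sum_mono norm_sum)
    also have "\<dots> = (\<Sum>i<n. \<Sum>j<n. if (vs ! i, vs ! j) \<in> parcs G
        then \<bar>f (vs ! i)\<bar> * \<bar>f (vs ! j)\<bar> / sqrt (?d (vs ! i) * ?d (vs ! j)) else 0)"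
      by (intro sum.cong refl) (simp add: f B_def norm_mult norm_divide)
    also have "\<dots> = (\<Sum>(v, w)\<in>parcs G. \<bar>f v\<bar> * \<bar>f w\<bar> / sqrt (?d v * ?d w))"
      by (rule by_index)
    also have "\<dots> \<le> (\<Sum>v\<in>pverts G. (f v)\<^sup>2)"
      by (rule normalized_adjacency_form_le[OF assms(1)])
    also have "\<dots> = (\<Sum>i<n. (cmod (x i))\<^sup>2)"
      by (simp add: sum.reindex_bij_betw[OF bij, symmetric] f)
    finally show ?thesis .
  qed
  have "(\<Sum>i<n. \<Sum>j<n. A $$ (i, j) * B i j) = (\<Sum>i<n. \<Sum>j<n. if (vs ! i, vs ! j) \<in> parcs G
      then complex_of_real (?r (vs ! i) (vs ! j)) else 0)"
    by (intro sum.cong refl) (simp add: A_entry B_def)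
  also have "\<dots> = (\<Sum>(v, w)\<in>parcs G. complex_of_real (?r v w))"
    by (rule by_index)
  also have "\<dots> = complex_of_real (2 * randic_index G)"
    unfolding twice_randic_index[OF assms(1)] of_real_sum by (simp add: case_prod_beta)
  finally have "\<bar>2 * randic_index G\<bar> = cmod (\<Sum>i<n. \<Sum>j<n. A $$ (i, j) * B i j)"
    by (simp only: norm_of_real)
  also have "\<dots> \<le> (\<Sum>e\<leftarrow>es. cmod e)"
    by (rule hermitian_pairing_le_sum_eigenvalues[OF A herm es form])
  also have "\<dots> = graph_energy G vs"
    unfolding graph_energy_def Let_def A_def[symmetric]
    by (rule sum_order_char_poly[OF A es(1), symmetric])
  finally show ?thesis by linarith
qed

end
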